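(* Let $\mathbb{F}$ be a field, $d\ge3$, $V$ a vector space over $\mathbb{F}$ of dimension $d+1$, and $\Phi=(A;\{E_i\}_{i=0}^d;A^*;\{E^*_i\}_{i=0}^d)$ a CH system on $V$ with dual eigenvalue sequence $\{\theta^*_i\}_{i=0}^d$. Fix a nonzero vector $u\in E_0V$, and for $0\le i\le d$ let $v^*_i=(A^*-\theta^*_{d-i+1}I)\cdots(A^*-\theta^*_{d-1}I)(A^*-\theta^*_dI)u$. Then the transition matrix from the basis $\{E^*_iu\}_{i=0}^d$ to the basis $\{v^*_{d-i}\}_{i=0}^d$ of $V$ is upper triangular with $(i,j)$-entry $$(\theta^*_i-\theta^*_{j+1})(\theta^*_i-\theta^*_{j+2})\cdots(\theta^*_i-\theta^*_d)$$ for $0\le i\le j\le d$. Moreover, the transition matrix from $\{v^*_{d-i}\}_{i=0}^d$ to $\{E^*_iu\}_{i=0}^d$ is upper triangular with $(i,j)$-entry $$\frac{1}{(\theta^*_j-\theta^*_i)\cdots(\theta^*_j-\theta^*_{j-1})(\theta^*_j-\theta^*_{j+1})\cdots(\theta^*_j-\theta^*_d)}$$ for $0\le i\le j\le d$.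
   Context: An element of $\mathrm{End}(V)$ is multiplicity-free if it is diagonalizable with all eigenspaces of dimension one. The primitive idempotent of a multiplicity-free $B$ for an eigenvalue $\theta$ is the $E\in\mathrm{End}(V)$ acting as the identity on the $\theta$-eigenspace and as $0$ on the other eigenspaces. A CH system on $V$ is a sequence $\Phi=(A;\{E_i\}_{i=0}^d;A^*;\{E^*_i\}_{i=0}^d)$ in $\mathrm{End}(V)$ such that: (i) $A,A^*$ are multiplicity-free; (ii) $\{E_i\}$ is an ordering of the primitive idempotents of $A$; (iii) $\{E^*_i\}$ is an ordering of the primitive idempotents of $A^*$; (iv) $E_iA^*E_j=0$ if $1<i-j$ or $1<j-i<d$, and $E_iA^*E_j\neq0$ if $i-j=1$ or $j-i=d$; (v) $E^*_iAE^*_j=0$ if $1<i-j$ or $1<j-i<d$, and $E^*_iAE^*_j\neq0$ if $i-j=1$ or $j-i=d$ $(0\le i,j\le d)$. The dual eigenvalue sequence $\{\theta^*_i\}_{i=0}^d$ is defined by: $\theta^*_i$ is the eigenvalue of $A^*$ corresponding to $E^*_i$. It is known that $\{E^*_iu\}_{i=0}^d$ and $\{v^*_i\}_{i=0}^d$ are bases of $V$. The transition matrix from a basis $\{x_i\}_{i=0}^d$ to a basis $\{y_i\}_{i=0}^d$ is the matrix $T$ (rows and columns indexed by $0,\dots,d$) with $y_j=\sum_{i=0}^dT_{ij}x_i$ for $0\le j\le d$. Empty products equal $1$; in the last displayed denominator the product is over all $k$ with $i\le k\le d$, $k\ne j$, of $(\theta^*_j-\theta^*_k)$. *)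

theory Defs
  imports Complex_Main "Jordan_Normal_Form.Matrix"
begin

text \<open>
  The vector space \<open>V\<close> is the whole type \<open>'b\<close>, with scalars from an arbitrary field \<open>'a\<close>;
  elements of \<open>End(V)\<close> are functions \<open>'b \<Rightarrow> 'b\<close> satisfying \<^const>\<open>Vector_Spaces.linear\<close>.
  Families indexed by \<open>0, \<dots>, d\<close> are functions on \<^typ>\<open>nat\<close> whose values beyond \<open>d\<close> are irrelevant.
\<close>

context
  fixes scale :: "'a::field \<Rightarrow> 'b::ab_group_add \<Rightarrow> 'b" (infixr \<open>*s\<close> 75)
begin

definition eigenspace :: "('b \<Rightarrow> 'b) \<Rightarrow> 'a \<Rightarrow> 'b set" where
  "eigenspace B \<theta> = {v. B v = \<theta> *s v}"

definition is_eigenvalue :: "('b \<Rightarrow> 'b) \<Rightarrow> 'a \<Rightarrow> bool" where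
  "is_eigenvalue B \<theta> \<longleftrightarrow> (\<exists>v. v \<noteq> 0 \<and> v \<in> eigenspace B \<theta>)"

definition diagonalizable :: "('b \<Rightarrow> 'b) \<Rightarrow> bool" where
  "diagonalizable B \<longleftrightarrow>
     (\<exists>S. \<not> module.dependent scale S \<and> module.span scale S = UNIV \<and> (\<forall>v\<in>S. \<exists>\<theta>. v \<in> eigenspace B \<theta>))"

definition multiplicity_free :: "('b \<Rightarrow> 'b) \<Rightarrow> bool" where
  "multiplicity_free B \<longleftrightarrow>
     Vector_Spaces.linear scale scale B \<and> diagonalizable B \<and>
     (\<forall>\<theta>. is_eigenvalue B \<theta> \<longrightarrow> vector_space.dim scale (eigenspace B \<theta>) = 1)"

definition primitive_idempotent :: "('b \<Rightarrow> 'b) \<Rightarrow> 'a \<Rightarrow> ('b \<Rightarrow> 'b) \<Rightarrow> bool" where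
  "primitive_idempotent B \<theta> E \<longleftrightarrow>
     is_eigenvalue B \<theta> \<and> Vector_Spaces.linear scale scale E \<and>
     (\<forall>v\<in>eigenspace B \<theta>. E v = v) \<and>
     (\<forall>\<eta>. is_eigenvalue B \<eta> \<and> \<eta> \<noteq> \<theta> \<longrightarrow> (\<forall>v\<in>eigenspace B \<eta>. E v = 0))"

definition primitive_idempotent_ordering :: "nat \<Rightarrow> ('b \<Rightarrow> 'b) \<Rightarrow> (nat \<Rightarrow> 'b \<Rightarrow> 'b) \<Rightarrow> bool" where
  "primitive_idempotent_ordering d B E \<longleftrightarrow>
     bij_betw E {0..d} {F. \<exists>\<theta>. primitive_idempotent B \<theta> F}"

text \<open>
  The conditions on \<open>i - j\<close> and \<open>j - i\<close>, which concern differences of integers, are written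
  additively to avoid truncated subtraction.
\<close>

definition circular_hessenberg :: "nat \<Rightarrow> (nat \<Rightarrow> 'b \<Rightarrow> 'b) \<Rightarrow> ('b \<Rightarrow> 'b) \<Rightarrow> bool" where
  "circular_hessenberg d E B \<longleftrightarrow>
     (\<forall>i\<le>d. \<forall>j\<le>d.
        ((j + 1 < i \<or> (i + 1 < j \<and> j < i + d)) \<longrightarrow> E i \<circ> B \<circ> E j = (\<lambda>_. 0)) \<and>
        ((i = j + 1 \<or> j = i + d) \<longrightarrow> E i \<circ> B \<circ> E j \<noteq> (\<lambda>_. 0)))"

definition CH_system ::
    "nat \<Rightarrow> ('b \<Rightarrow> 'b) \<Rightarrow> (nat \<Rightarrow> 'b \<Rightarrow> 'b) \<Rightarrow> ('b \<Rightarrow> 'b) \<Rightarrow> (nat \<Rightarrow> 'b \<Rightarrow> 'b) \<Rightarrow> bool" where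
  "CH_system d A E As Es \<longleftrightarrow>
     multiplicity_free A \<and> multiplicity_free As \<and>
     primitive_idempotent_ordering d A E \<and>
     primitive_idempotent_ordering d As Es \<and>
     circular_hessenberg d E As \<and>
     circular_hessenberg d Es A"

definition eigenvalue_sequence ::
    "nat \<Rightarrow> ('b \<Rightarrow> 'b) \<Rightarrow> (nat \<Rightarrow> 'b \<Rightarrow> 'b) \<Rightarrow> (nat \<Rightarrow> 'a) \<Rightarrow> bool" where
  "eigenvalue_sequence d B E \<theta> \<longleftrightarrow> (\<forall>i\<le>d. primitive_idempotent B (\<theta> i) (E i))"

definition is_basis :: "nat \<Rightarrow> (nat \<Rightarrow> 'b) \<Rightarrow> bool" where
  "is_basis d x \<longleftrightarrow> inj_on x {0..d} \<and> \<not> module.dependent scale (x ` {0..d}) \<and> module.span scale (x ` {0..d}) = UNIV"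

definition transition_matrix :: "nat \<Rightarrow> (nat \<Rightarrow> 'b) \<Rightarrow> (nat \<Rightarrow> 'b) \<Rightarrow> 'a mat" where
  "transition_matrix d x y =
     (THE T. T \<in> carrier_mat (d + 1) (d + 1) \<and>
             (\<forall>j\<le>d. y j = (\<Sum>i=0..d. (T $$ (i, j)) *s x i)))"

text \<open>
  The fold runs over \<open>d - i + 1, \<dots>, d\<close> from the right, so the factor with index \<open>d\<close> is applied
  to \<open>u\<close> first.
\<close>

definition v_star :: "nat \<Rightarrow> ('b \<Rightarrow> 'b) \<Rightarrow> (nat \<Rightarrow> 'a) \<Rightarrow> 'b \<Rightarrow> nat \<Rightarrow> 'b" where
  "v_star d As \<theta>s u i = foldr (\<lambda>k w. As w - \<theta>s k *s w) [d - i + 1..<d + 1] u"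

lemma transition_matrix_ex1:
  assumes "vector_space scale" and "is_basis d x"
  shows "\<exists>!T. T \<in> carrier_mat (d + 1) (d + 1) \<and>
              (\<forall>j\<le>d. y j = (\<Sum>i=0..d. (T $$ (i, j)) *s x i))"
proof -
  interpret vector_space scale by fact
  have inj: "inj_on x {0..d}" and ind: "independent (x ` {0..d})"
    and spn: "span (x ` {0..d}) = UNIV"
    using assms(2) by (auto simp: is_basis_def)
  let ?R = "representation (x ` {0..d})"
  have rep: "(\<Sum>i=0..d. ?R v (x i) *s x i) = v" for v
  proof -
    have "(\<Sum>b\<in>x ` {0..d}. ?R v b *s b) = v"
      by (rule sum_representation_eq[OF ind]) (auto simp: spn)
    then show ?thesis by (simp add: sum.reindex[OF inj])
  qed
  have uniq: "\<forall>i\<le>d. c i = e i"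
    if "(\<Sum>i=0..d. c i *s x i) = (\<Sum>i=0..d. e i *s x i)" for c e
  proof -
    define g where "g b = c (inv_into {0..d} x b) - e (inv_into {0..d} x b)" for b
    have "(\<Sum>b\<in>x ` {0..d}. g b *s b) = (\<Sum>i=0..d. (c i - e i) *s x i)"
      by (simp add: sum.reindex[OF inj] g_def inv_into_f_f[OF inj])
    also have "\<dots> = 0" using that by (simp add: scale_left_diff_distrib sum_subtractf)
    finally have sum0: "(\<Sum>b\<in>x ` {0..d}. g b *s b) = 0" .
    have "\<forall>b\<in>x ` {0..d}. g b = 0"
    proof
      fix b assume "b \<in> x ` {0..d}"
      then show "g b = 0"
        by (rule independentD[OF ind finite_imageI[OF finite_atLeastAtMost] subset_refl sum0])
    qed
    then show ?thesis by (auto simp: g_def inv_into_f_f[OF inj])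
  qed
  let ?M = "mat (d + 1) (d + 1) (\<lambda>(i, j). ?R (y j) (x i))"
  have M: "(\<Sum>i=0..d. (?M $$ (i, j)) *s x i) = y j" if "j \<le> d" for j
  proof -
    have "(\<Sum>i=0..d. (?M $$ (i, j)) *s x i) = (\<Sum>i=0..d. ?R (y j) (x i) *s x i)"
      by (rule sum.cong) (use that in auto)
    then show ?thesis by (simp only: rep)
  qed
  show ?thesis
  proof (rule ex1I[of _ ?M], intro conjI allI impI)
    show "?M \<in> carrier_mat (d + 1) (d + 1)" by simp
    show "y j = (\<Sum>i=0..d. (?M $$ (i, j)) *s x i)" if "j \<le> d" for j
      by (rule M[OF that, symmetric])
  next
    fix T
    assume T: "T \<in> carrier_mat (d + 1) (d + 1) \<and>
      (\<forall>j\<le>d. y j = (\<Sum>i=0..d. (T $$ (i, j)) *s x i))"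
    have "T $$ (i, j) = ?M $$ (i, j)" if "i \<le> d" "j \<le> d" for i j
    proof -
      have "(\<Sum>i=0..d. (T $$ (i, j)) *s x i) = y j" using T that(2) by simp
      then have "(\<Sum>i=0..d. (T $$ (i, j)) *s x i) = (\<Sum>i=0..d. (?M $$ (i, j)) *s x i)"
        by (simp only: M[OF that(2)])
      from uniq[OF this] show ?thesis using that(1) by simp
    qed
    then show "T = ?M"
      using T by (intro eq_matI) auto
  qed
qed

end

end

theory Submission
  imports Defs
begin

text \<open>
  Since \<open>E\<^sub>i A\<^sup>* E\<^sub>j\<close> vanishes below the subdiagonal and is nonzero on it, \<open>u\<close> is a cyclic vector
  for \<open>A\<^sup>*\<close>. The kernel of \<open>E\<^sup>*\<^sub>i\<close> is a proper \<open>A\<^sup>*\<close>-invariant subspace, so it does not contain \<open>u\<close>,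
  and the \<open>E\<^sup>*\<^sub>i u\<close> are nonzero eigenvectors of \<open>A\<^sup>*\<close> for distinct eigenvalues, hence a basis. As
  \<open>u\<close> is the sum of the \<open>E\<^sup>*\<^sub>i u\<close>, the first transition matrix is read off from the action of \<open>A\<^sup>*\<close> on
  eigenvectors. The second one is its inverse by a telescoping sum.
\<close>

section \<open>Scalar identities for the two matrices\<close>

text \<open>Write \<open>R m\<close> for the quotient on the right. After multiplication by
  \<open>\<theta> j - a\<close> the summand at \<open>i < j\<close> is \<open>R (i+1) - R i\<close>,
  and the one at \<open>i = j\<close> is \<open>- R j\<close>, so only \<open>- R m\<close>
  survives.\<close>

lemma telescoping_product_sum:
  fixes \<theta> :: "nat \<Rightarrow> 'a::field"
  assumes inj: "inj_on \<theta> {0..d}" and "j \<le> d" "m \<le> j"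
  shows "(\<theta> j - a) * (\<Sum>i=m..j. (\<Prod>k=i+1..d. a - \<theta> k) / (\<Prod>k\<in>{i..d} - {j}. \<theta> j - \<theta> k)) =
    - ((\<Prod>k=m..d. a - \<theta> k) / (\<Prod>k\<in>{m..d} - {j}. \<theta> j - \<theta> k))"
  using \<open>m \<le> j\<close>
proof (induction m rule: inc_induct)
  case base
  have "{j..d} = insert j {j+1..d}" using \<open>j \<le> d\<close> by auto
  then show ?case by (simp add: left_diff_distrib diff_divide_distrib)
next
  case (step m)
  have 1: "{m..d} = insert m {Suc m..d}" using step \<open>j \<le> d\<close> by auto
  have 2: "{m..d} - {j} = insert m ({Suc m..d} - {j})" using step \<open>j \<le> d\<close> by auto
  have 3: "{m..j} = insert m {Suc m..j}" using step by auto
  have nz: "\<theta> j - \<theta> m \<noteq> 0"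
    using inj_onD[OF inj, of j m] step \<open>j \<le> d\<close> by auto
  \<comment> \<open>One telescoping step: \<open>b\<close>, \<open>c\<close> stand for
    \<open>\<theta> j\<close>, \<open>\<theta> m\<close>, while \<open>p\<close>, \<open>q\<close>,
    \<open>s\<close> are the two products and the sum starting at \<open>Suc m\<close>.\<close>
  have key: "(b - a) * (p / ((b - c) * q) + s) = - (((a - c) * p) / ((b - c) * q))"
    if "(b - a) * s = - (p / q)" "b - c \<noteq> 0" for b c p q s :: 'a
  proof -
    have "p / q = (b - c) * p / ((b - c) * q)" using that(2) by simp
    then have "(b - a) * (p / ((b - c) * q) + s) = ((b - a) * p - (b - c) * p) / ((b - c) * q)"
      unfolding distrib_left that(1) by (simp add: diff_divide_distrib)
    also have "(b - a) * p - (b - c) * p = - ((a - c) * p)" by (simp add: algebra_simps)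
    finally show ?thesis by simp
  qed
  have "(\<Prod>k=m..d. a - \<theta> k) = (a - \<theta> m) * (\<Prod>k=Suc m..d. a - \<theta> k)"
    unfolding 1 by simp
  moreover have "(\<Prod>k\<in>{m..d} - {j}. \<theta> j - \<theta> k) =
      (\<theta> j - \<theta> m) * (\<Prod>k\<in>{Suc m..d} - {j}. \<theta> j - \<theta> k)"
    unfolding 2 by simp
  ultimately show ?case
    using key[OF step.IH nz] by (simp add: 3)
qed

text \<open>This is entry \<open>(l, j)\<close> of the first matrix times the second. For
  \<open>l \<noteq> j\<close>, telescoping from \<open>0\<close> with \<open>a = \<theta> l\<close>
  leaves a product with the factor \<open>\<theta> l - \<theta> l\<close>. For \<open>l = j\<close>,
  every term with \<open>i < j\<close> contains the zero factor at \<open>k = j\<close>.\<close>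

lemma divided_difference_identity:
  fixes \<theta> :: "nat \<Rightarrow> 'a::field"
  assumes inj: "inj_on \<theta> {0..d}" and "j \<le> d" "l \<le> d"
  shows "(\<Sum>i=0..j. (\<Prod>k=i+1..d. \<theta> l - \<theta> k) / (\<Prod>k\<in>{i..d} - {j}. \<theta> j - \<theta> k)) =
    (if l = j then 1 else 0)"
proof (cases "l = j")
  case False
  have "\<theta> j - \<theta> l \<noteq> 0" using inj_onD[OF inj, of j l] assms False by auto
  moreover have "(\<Prod>k=0..d. \<theta> l - \<theta> k) = 0"
    using \<open>l \<le> d\<close> by (intro prod_zero) auto
  then have "(\<theta> j - \<theta> l) * (\<Sum>i=0..j.
      (\<Prod>k=i+1..d. \<theta> l - \<theta> k) / (\<Prod>k\<in>{i..d} - {j}. \<theta> j - \<theta> k)) = 0"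
    using telescoping_product_sum[OF inj \<open>j \<le> d\<close>, of 0 "\<theta> l"] by (simp only: div_0 minus_zero le0)
  ultimately show ?thesis unfolding mult_eq_0_iff using False by auto
next
  case True
  have nz: "(\<Prod>k\<in>{j+1..d}. \<theta> j - \<theta> k) \<noteq> 0"
    using \<open>j \<le> d\<close> by (auto simp: inj_on_eq_iff[OF inj])
  have "(\<Prod>k=i+1..d. \<theta> j - \<theta> k) = 0" if "i < j" for i
    using that \<open>j \<le> d\<close> by (intro prod_zero) auto
  then have "(\<Sum>i=0..j. (\<Prod>k=i+1..d. \<theta> j - \<theta> k) / (\<Prod>k\<in>{i..d} - {j}. \<theta> j - \<theta> k)) =
      (\<Sum>i\<in>{j}. (\<Prod>k=i+1..d. \<theta> j - \<theta> k) / (\<Prod>k\<in>{i..d} - {j}. \<theta> j - \<theta> k))"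
    by (intro sum.mono_neutral_right) auto
  also have "\<dots> = 1"
  proof -
    have "{j..d} - {j} = {j+1..d}" by auto
    then show ?thesis using nz by simp
  qed
  finally show ?thesis using True by simp
qed

section \<open>Bases and transition matrices for families indexed by \<open>0..d\<close>\<close>

context vector_space
begin

text \<open>An infinite basis has \<open>card\<close> equal to 0, so a positive \<open>dim\<close>
  forces a finite one.\<close>

lemma finite_dimensional_if_dim_pos:
  assumes "dim (UNIV :: 'b set) > 0"
  obtains Basis where "finite_dimensional_vector_space scale Basis"
proof -
  obtain b where b: "independent b" "UNIV \<subseteq> span b" "card b = dim (UNIV :: 'b set)"
    using basis_exists by blast
  with assms have "finite b" by (metis card.infinite less_irrefl)
  with b have "finite_dimensional_vector_space scale b"
    by unfold_locales auto
  then show ?thesis by (rule that)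
qed

text \<open>Serves for the \<open>v_star\<close> family, for which spanning is the accessible half;
  counting gives injectivity and independence.\<close>

lemma is_basisI_span:
  assumes dim: "dim (UNIV :: 'b set) = d + 1" and span: "span (x ` {0..d}) = UNIV"
  shows "is_basis scale d x"
proof -
  obtain Basis where "finite_dimensional_vector_space scale Basis"
    using finite_dimensional_if_dim_pos dim by auto
  then interpret finite_dimensional_vector_space scale Basis .
  have le: "card (x ` {0..d}) \<le> d + 1" using card_image_le[of "{0..d}" x] by simp
  have ge: "d + 1 \<le> card (x ` {0..d})"
    using dim_le_card[of UNIV "x ` {0..d}"] span dim by simp
  have "inj_on x {0..d}" using le ge by (intro eq_card_imp_inj_on) auto
  moreover have "independent (x ` {0..d})"
    using card_le_dim_spanning[of "x ` {0..d}" UNIV] span dim le by simp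
  ultimately show ?thesis using span by (simp add: is_basis_def)
qed

lemma is_basisI_independent:
  assumes dim: "dim (UNIV :: 'b set) = d + 1"
    and ind: "\<And>c i. (\<Sum>i=0..d. c i *s x i) = 0 \<Longrightarrow> i \<le> d \<Longrightarrow> c i = 0"
  shows "is_basis scale d x"
proof -
  obtain Basis where "finite_dimensional_vector_space scale Basis"
    using finite_dimensional_if_dim_pos dim by auto
  then interpret finite_dimensional_vector_space scale Basis .
  have inj: "inj_on x {0..d}"
  proof (rule inj_onI, rule ccontr)
    fix i j assume ij: "i \<in> {0..d}" "j \<in> {0..d}" "x i = x j" "i \<noteq> j"
    \<comment> \<open>A repeated vector would give a vanishing combination with coefficients
      \<open>1\<close> and \<open>-1\<close>, so independence over indices includes
      injectivity.\<close>
    have "(\<Sum>k=0..d. (if k = i then 1 else if k = j then -1 else 0) *s x k) =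
        (\<Sum>k\<in>{i, j}. (if k = i then 1 else if k = j then -1 else 0) *s x k)"
      using ij by (intro sum.mono_neutral_right) auto
    also have "\<dots> = 0" using ij by simp
    finally show False using ind[of _ i] ij by fastforce
  qed
  have "independent (x ` {0..d})"
  proof (rule independent_if_scalars_zero)
    fix f v assume "(\<Sum>v\<in>x ` {0..d}. f v *s v) = 0" "v \<in> x ` {0..d}"
    then show "f v = 0" using ind[of "\<lambda>i. f (x i)"] by (auto simp: sum.reindex[OF inj])
  qed simp
  moreover from this have "span (x ` {0..d}) = UNIV"
    using card_ge_dim_independent[of "x ` {0..d}" UNIV] dim card_image[OF inj] by auto
  ultimately show ?thesis using inj by (simp add: is_basis_def)
qed

lemma is_basis_expand:
  assumes "is_basis scale d x"
  obtains c where "v = (\<Sum>i=0..d. c i *s x i)"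
proof -
  have *: "inj_on x {0..d}" "independent (x ` {0..d})" "span (x ` {0..d}) = UNIV"
    using assms by (auto simp: is_basis_def)
  have "(\<Sum>b\<in>x ` {0..d}. representation (x ` {0..d}) v b *s b) = v"
    by (rule sum_representation_eq) (auto simp: *)
  then show ?thesis by (intro that[of "\<lambda>i. representation (x ` {0..d}) v (x i)"]) (simp add: sum.reindex[OF *(1)])
qed

lemma transition_matrix_eqI:
  assumes "is_basis scale d x" "M \<in> carrier_mat (d + 1) (d + 1)"
    and "\<And>j. j \<le> d \<Longrightarrow> y j = (\<Sum>i=0..d. (M $$ (i, j)) *s x i)"
  shows "transition_matrix scale d x y = M"
  unfolding transition_matrix_def
  by (rule the1_equality[OF transition_matrix_ex1[OF vector_space_axioms assms(1)]])
    (use assms in auto)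

end

section \<open>Multiplicity-free maps and their primitive idempotents\<close>

text \<open>One half of a CH system, isolated so that both \<open>A\<close> and \<open>As\<close>
  can be instances.\<close>

locale multiplicity_free_system = vector_space scale
  for scale :: "'a::field \<Rightarrow> 'b::ab_group_add \<Rightarrow> 'b" (infixr \<open>*s\<close> 75) +
  fixes d :: nat and B :: "'b \<Rightarrow> 'b" and E :: "nat \<Rightarrow> 'b \<Rightarrow> 'b" and \<theta> :: "nat \<Rightarrow> 'a"
  assumes dim_eq: "dim (UNIV :: 'b set) = d + 1"
    and mult_free: "multiplicity_free scale B"
    and ordering: "primitive_idempotent_ordering scale d B E"
    and eigseq: "eigenvalue_sequence scale d B E \<theta>"
begin

sublocale B: Vector_Spaces.linear scale scale B
  using mult_free by (simp add: multiplicity_free_def)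

lemma primitive_idempotent: "i \<le> d \<Longrightarrow> primitive_idempotent scale B (\<theta> i) (E i)"
  using eigseq by (simp add: eigenvalue_sequence_def)

lemma linear_E: "i \<le> d \<Longrightarrow> Vector_Spaces.linear scale scale (E i)"
  using primitive_idempotent by (simp add: primitive_idempotent_def)

lemma
  assumes "i \<le> d"
  shows E_add: "E i (v + w) = E i v + E i w"
    and E_scale: "E i (c *s v) = c *s E i v"
    and E_zero: "E i 0 = 0"
    and E_sum: "E i (sum f I) = (\<Sum>k\<in>I. E i (f k))"
proof -
  interpret Ei: Vector_Spaces.linear scale scale "E i" by (rule linear_E[OF assms])
  show "E i (v + w) = E i v + E i w" "E i (c *s v) = c *s E i v"
    "E i 0 = 0" "E i (sum f I) = (\<Sum>k\<in>I. E i (f k))"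
    by (rule Ei.add Ei.scale Ei.zero Ei.sum)+
qed

text \<open>Eigenvectors span the space, so a primitive idempotent is determined by its eigenvalue;
  the ordering lists each idempotent only once.\<close>

lemma inj_eigenvalues: "inj_on \<theta> {0..d}"
proof (rule inj_onI)
  fix i j assume ij: "i \<in> {0..d}" "j \<in> {0..d}" "\<theta> i = \<theta> j"
  obtain S where S: "independent S" "span S = UNIV" "\<forall>v\<in>S. \<exists>\<eta>. v \<in> eigenspace scale B \<eta>"
  proof -
    have "diagonalizable scale B" using mult_free by (simp add: multiplicity_free_def)
    then show ?thesis unfolding diagonalizable_def by (elim exE conjE) (rule that)
  qed
  have agree: "E i v = E j v" if "v \<in> S" for v
  proof -
    obtain \<eta> where \<eta>: "v \<in> eigenspace scale B \<eta>" using S(3) \<open>v \<in> S\<close> by auto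
    have "v \<noteq> 0" using S(1) that dependent_zero[of S] by auto
    with \<eta> have "is_eigenvalue scale B \<eta>" by (auto simp: is_eigenvalue_def)
    then show ?thesis
      using primitive_idempotent[of i] primitive_idempotent[of j] ij \<eta>
      by (cases "\<eta> = \<theta> j") (simp_all add: primitive_idempotent_def)
  qed
  interpret vector_space_pair scale scale ..
  have "E i = E j"
    using agree linear_eq_on[of "E i" "E j" _ S] linear_E ij S(2) by (intro ext) simp
  then show "i = j"
    using ordering ij
    by (auto simp: primitive_idempotent_ordering_def bij_betw_def dest: inj_onD)
qed

lemma E_eigenvector:
  assumes "i \<le> d" "j \<le> d" "B v = \<theta> j *s v"
  shows "E i v = (if i = j then v else 0)"
proof -
  have "is_eigenvalue scale B (\<theta> j)" "v \<in> eigenspace scale B (\<theta> j)"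
    using assms primitive_idempotent[of j] by (auto simp: primitive_idempotent_def eigenspace_def)
  moreover have "\<theta> i = \<theta> j \<longleftrightarrow> i = j"
    using inj_onD[OF inj_eigenvalues, of i j] assms by auto
  ultimately show ?thesis
    using primitive_idempotent[of i] assms by (auto simp: primitive_idempotent_def)
qed

lemma E_sum_eigenvectors:
  assumes "\<And>i. i \<le> d \<Longrightarrow> B (w i) = \<theta> i *s w i" and "i \<le> d"
  shows "E i (\<Sum>k=0..d. c k *s w k) = c i *s w i"
proof -
  have "E i (\<Sum>k=0..d. c k *s w k) = (\<Sum>k=0..d. if k = i then c i *s w i else 0)"
    unfolding E_sum[OF \<open>i \<le> d\<close>]
    by (rule sum.cong) (auto simp: E_scale E_eigenvector assms)
  then show ?thesis using \<open>i \<le> d\<close> by simp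
qed

text \<open>Applying \<open>E i\<close> to a vanishing combination isolates its \<open>i\<close>-th
  term; the dimension then turns independence into a basis.\<close>

lemma eigenvectors_basis:
  assumes "\<And>i. i \<le> d \<Longrightarrow> B (w i) = \<theta> i *s w i" and nz: "\<And>i. i \<le> d \<Longrightarrow> w i \<noteq> 0"
  shows "is_basis scale d w"
proof (rule is_basisI_independent[OF dim_eq])
  fix c i assume "(\<Sum>i=0..d. c i *s w i) = 0" "i \<le> d"
  then have "c i *s w i = 0" using E_sum_eigenvectors[of w i c] assms E_zero by simp
  then show "c i = 0" using nz \<open>i \<le> d\<close> by simp
qed

lemma obtain_eigenvectors:
  obtains w where "\<And>i. i \<le> d \<Longrightarrow> B (w i) = \<theta> i *s w i" "\<And>i. i \<le> d \<Longrightarrow> w i \<noteq> 0"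
proof -
  have "\<forall>i\<in>{..d}. \<exists>w. B w = \<theta> i *s w \<and> w \<noteq> 0"
    using primitive_idempotent
    unfolding primitive_idempotent_def is_eigenvalue_def eigenspace_def by blast
  then obtain w where "\<forall>i\<in>{..d}. B (w i) = \<theta> i *s w i \<and> w i \<noteq> 0"
    using bchoice by metis
  then show ?thesis by (intro that) auto
qed

text \<open>Both equations are read off in a basis of eigenvectors. The second one makes the kernel
  of \<open>E i\<close> invariant under \<open>B\<close>.\<close>

lemma B_E:
  assumes "i \<le> d"
  shows "B (E i v) = \<theta> i *s E i v" "E i (B v) = \<theta> i *s E i v"
proof -
  obtain w where w: "\<And>i. i \<le> d \<Longrightarrow> B (w i) = \<theta> i *s w i" "\<And>i. i \<le> d \<Longrightarrow> w i \<noteq> 0"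
    using obtain_eigenvectors by blast
  obtain c where c: "v = (\<Sum>i=0..d. c i *s w i)"
    using is_basis_expand eigenvectors_basis[of w] w by blast
  have Bv: "B v = (\<Sum>i=0..d. (c i * \<theta> i) *s w i)"
    unfolding c B.sum by (rule sum.cong) (auto simp: B.scale w)
  show "B (E i v) = \<theta> i *s E i v"
    using E_sum_eigenvectors[of w i c] w assms by (simp add: c B.scale mult.commute)
  show "E i (B v) = \<theta> i *s E i v"
    unfolding Bv unfolding c
    using E_sum_eigenvectors[of w i] w assms by (simp add: mult.commute)
qed

lemma sum_E: "(\<Sum>i=0..d. E i v) = v"
proof -
  obtain w where w: "\<And>i. i \<le> d \<Longrightarrow> B (w i) = \<theta> i *s w i" "\<And>i. i \<le> d \<Longrightarrow> w i \<noteq> 0"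
    using obtain_eigenvectors by blast
  obtain c where c: "v = (\<Sum>i=0..d. c i *s w i)"
    using is_basis_expand eigenvectors_basis[of w] w by blast
  show ?thesis
    using E_sum_eigenvectors[of w _ c] w by (simp add: c)
qed

lemma E_nonzero:
  assumes "i \<le> d"
  obtains v where "E i v \<noteq> 0"
proof -
  obtain w where "B (w i) = \<theta> i *s w i" "w i \<noteq> 0"
    using obtain_eigenvectors assms by blast
  then show ?thesis using E_eigenvector[OF assms assms] by (intro that[of "w i"]) simp
qed

text \<open>In a basis of eigenvectors \<open>E i\<close> kills all members but \<open>w i\<close>,
  so its image is a line.\<close>

lemma rank_one:
  assumes "i \<le> d" "E i z \<noteq> 0"
  obtains c where "E i v = c *s E i z"
proof -
  obtain w where w: "\<And>i. i \<le> d \<Longrightarrow> B (w i) = \<theta> i *s w i" "\<And>i. i \<le> d \<Longrightarrow> w i \<noteq> 0"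
    using obtain_eigenvectors by blast
  have E_w: "\<exists>c. E i v = c *s w i" for v
  proof -
    obtain c where c: "v = (\<Sum>i=0..d. c i *s w i)"
      using is_basis_expand eigenvectors_basis[of w] w by blast
    show ?thesis
      using E_sum_eigenvectors[of w i c] w assms(1) c by auto
  qed
  obtain a b where ab: "E i v = a *s w i" "E i z = b *s w i"
    using E_w by meson
  with assms(2) have "b \<noteq> 0" by auto
  with ab show ?thesis by (intro that[of "a / b"]) simp
qed

text \<open>
  With respect to eigenvectors of \<open>B\<close> the map \<open>C\<close> is upper Hessenberg with nonzero subdiagonal,
  so \<open>E 0 z\<close> is a cyclic vector for \<open>C\<close>.
\<close>

lemma hessenberg_cyclic:
  assumes W: "subspace W" "\<And>v. v \<in> W \<Longrightarrow> C v \<in> W"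
    and z: "E 0 z \<in> W" "E 0 z \<noteq> 0"
    and zero: "\<And>i j v. i \<le> d \<Longrightarrow> j + 1 < i \<Longrightarrow> E i (C (E j v)) = 0"
    and nonzero: "\<And>j. j < d \<Longrightarrow> \<exists>v. E (Suc j) (C (E j v)) \<noteq> 0"
  shows "W = UNIV"
proof -
  have "\<forall>v. E j v \<in> W" if "j \<le> d" for j
    using that
  proof (induction j rule: less_induct)
    case (less j)
    show ?case
    proof
      fix v
      show "E j v \<in> W"
      proof (cases j)
        case 0
        obtain c where "E 0 v = c *s E 0 z" by (rule rank_one[OF _ z(2)]) simp_all
        then show ?thesis using 0 z(1) subspace_scale[OF W(1)] by simp
      next
        case (Suc k)
        \<comment> \<open>The vector \<open>?q\<close> lies in \<open>W\<close>, has no component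
          beyond \<open>j\<close> by \<open>zero\<close>, and its components below \<open>j\<close>
          lie in \<open>W\<close> by induction. Hence its nonzero \<open>j\<close>-th component lies
          in \<open>W\<close>, and by \<open>rank_one\<close> it spans the image of
          \<open>E j\<close>.\<close>
        obtain y where y: "E j (C (E k y)) \<noteq> 0" using nonzero[of k] Suc less.prems by auto
        let ?q = "C (E k y)"
        have "?q \<in> W" using less.IH[of k] less.prems Suc W(2) by simp
        moreover have "(\<Sum>i<j. E i ?q) \<in> W"
          using less by (intro subspace_sum[OF W(1)]) simp
        moreover have "E j ?q = ?q - (\<Sum>i<j. E i ?q)"
        proof -
          have "?q = (\<Sum>i=0..d. E i ?q)" by (rule sum_E[symmetric])
          also have "\<dots> = (\<Sum>i\<le>j. E i ?q)"
            by (rule sum.mono_neutral_right) (use zero Suc less.prems in auto)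
          also have "{..j} = insert j {..<j}" by auto
          finally show ?thesis by (simp add: algebra_simps)
        qed
        ultimately have "E j ?q \<in> W"
          using subspace_diff[OF W(1)] by (simp only:)
        moreover obtain c where "E j v = c *s E j ?q"
          by (rule rank_one[OF less.prems y])
        ultimately show ?thesis using subspace_scale[OF W(1)] by simp
      qed
    qed
  qed
  then have "(\<Sum>i=0..d. E i v) \<in> W" for v
    by (intro subspace_sum[OF W(1)]) simp
  then show ?thesis by (auto simp: sum_E)
qed

section \<open>Passing between the \<open>v_star\<close> family and the vectors
  \<open>E i u\<close>\<close>

text \<open>Start from \<open>u\<close> as the sum of the \<open>E i u\<close>; the factor with
  index \<open>k\<close> multiplies the eigenvector \<open>E i u\<close> by
  \<open>\<theta> i - \<theta> k\<close>.\<close>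

lemma v_star_eq:
  assumes "j \<le> d"
  shows "v_star scale d B \<theta> u (d - j) = (\<Sum>i=0..d. (\<Prod>k=j+1..d. \<theta> i - \<theta> k) *s E i u)"
  using assms
proof (induction j rule: inc_induct)
  case base
  show ?case by (simp add: v_star_def sum_E)
next
  case (step j)
  have *: "d - (d - j) + 1 = j + 1" "d - (d - Suc j) + 1 = j + 2" using step by auto
  \<comment> \<open>Going down from \<open>Suc j\<close> to \<open>j\<close> puts index
    \<open>j + 1\<close> at the head of the list, and \<open>foldr\<close> applies the head
    last.\<close>
  have upt: "[j + 1..<d + 1] = (j + 1) # [j + 2..<d + 1]" using step by (simp add: upt_rec)
  have set: "{j + 1..d} = insert (j + 1) {j + 2..d}" using step by auto
  let ?w = "\<Sum>i=0..d. (\<Prod>k=j+2..d. \<theta> i - \<theta> k) *s E i u"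
  have "v_star scale d B \<theta> u (d - j) =
      B (v_star scale d B \<theta> u (d - Suc j)) - \<theta> (j + 1) *s v_star scale d B \<theta> u (d - Suc j)"
    unfolding v_star_def * upt by simp
  also have "v_star scale d B \<theta> u (d - Suc j) = ?w" using step by simp
  also have "B ?w - \<theta> (j + 1) *s ?w =
      (\<Sum>i=0..d. ((\<Prod>k=j+2..d. \<theta> i - \<theta> k) * \<theta> i - \<theta> (j + 1) * (\<Prod>k=j+2..d. \<theta> i - \<theta> k)) *s E i u)"
    unfolding B.sum scale_sum_right sum_subtractf[symmetric]
    by (rule sum.cong) (auto simp: B.scale B_E scale_left_diff_distrib)
  also have "\<dots> = (\<Sum>i=0..d. (\<Prod>k=j+1..d. \<theta> i - \<theta> k) *s E i u)"
    unfolding set by (simp add: algebra_simps)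
  finally show ?case .
qed

text \<open>After substituting \<open>v_star_eq\<close> and swapping the sums, the coefficient of
  \<open>E l u\<close> is given by \<open>divided_difference_identity\<close>.\<close>

lemma E_eq_sum_v_star:
  assumes "j \<le> d"
  shows "E j u =
    (\<Sum>i=0..j. (1 / (\<Prod>k\<in>{i..d} - {j}. \<theta> j - \<theta> k)) *s v_star scale d B \<theta> u (d - i))"
proof -
  have "(\<Sum>i=0..j. (1 / (\<Prod>k\<in>{i..d} - {j}. \<theta> j - \<theta> k)) *s v_star scale d B \<theta> u (d - i)) =
      (\<Sum>i=0..j. \<Sum>l=0..d.
        ((\<Prod>k=i+1..d. \<theta> l - \<theta> k) / (\<Prod>k\<in>{i..d} - {j}. \<theta> j - \<theta> k)) *s E l u)"
    using assms by (intro sum.cong refl) (simp add: v_star_eq scale_sum_right)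
  also have "\<dots> = (\<Sum>l=0..d. (if l = j then 1 else 0) *s E l u)"
    by (subst sum.swap)
      (intro sum.cong refl, simp add: scale_sum_left[symmetric]
        divided_difference_identity[OF inj_eigenvalues assms, simplified])
  also have "\<dots> = (\<Sum>l=0..d. if l = j then E j u else 0)"
    by (rule sum.cong) auto
  also have "\<dots> = E j u" using assms by simp
  finally show ?thesis ..
qed

end

section \<open>Assembly for a CH system\<close>

text \<open>The theorem fixes eigenvalues for \<open>As\<close> only; the locale instance for
  \<open>A\<close> needs some as well.\<close>

lemma (in vector_space) obtain_eigenvalue_sequence:
  assumes "primitive_idempotent_ordering scale d B E"
  obtains \<theta> where "eigenvalue_sequence scale d B E \<theta>"
proof -
  have "\<forall>i\<in>{0..d}. \<exists>\<theta>. primitive_idempotent scale B \<theta> (E i)"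
    using assms by (auto simp: primitive_idempotent_ordering_def bij_betw_def)
  then obtain \<theta> where "\<forall>i\<in>{0..d}. primitive_idempotent scale B (\<theta> i) (E i)"
    using bchoice by metis
  then show ?thesis by (intro that[of \<theta>]) (simp add: eigenvalue_sequence_def)
qed

theorem lemma6p8:
  fixes scale :: "'a::field \<Rightarrow> 'b::ab_group_add \<Rightarrow> 'b"
    and d :: nat
    and A As :: "'b \<Rightarrow> 'b"
    and E Es :: "nat \<Rightarrow> 'b \<Rightarrow> 'b"
    and \<theta>s :: "nat \<Rightarrow> 'a"
    and u :: 'b
  assumes V: "vector_space scale"
    and d: "d \<ge> 3"
    and dim: "vector_space.dim scale (UNIV :: 'b set) = d + 1"
    and CH: "CH_system scale d A E As Es"
    and \<theta>s: "eigenvalue_sequence scale d As Es \<theta>s"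
    and u: "u \<in> range (E 0)" "u \<noteq> 0"
  defines "x \<equiv> \<lambda>i. Es i u"
    and "y \<equiv> \<lambda>i. v_star scale d As \<theta>s u (d - i)"
  defines "T \<equiv> transition_matrix scale d x y"
    and "S \<equiv> transition_matrix scale d y x"
  shows "is_basis scale d x \<and> is_basis scale d y \<and>
    upper_triangular T \<and>
    (\<forall>i j. i \<le> j \<and> j \<le> d \<longrightarrow> T $$ (i, j) = (\<Prod>k=j+1..d. \<theta>s i - \<theta>s k)) \<and>
    upper_triangular S \<and>
    (\<forall>i j. i \<le> j \<and> j \<le> d \<longrightarrow> S $$ (i, j) = 1 / (\<Prod>k\<in>{i..d} - {j}. \<theta>s j - \<theta>s k))"
proof -
  interpret vector_space scale by (rule V)
  have CH': "multiplicity_free scale A" "multiplicity_free scale As"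
    "primitive_idempotent_ordering scale d A E" "primitive_idempotent_ordering scale d As Es"
    "circular_hessenberg d E As"
    using CH by (auto simp: CH_system_def)
  obtain \<theta> where \<theta>: "eigenvalue_sequence scale d A E \<theta>"
    using obtain_eigenvalue_sequence[OF CH'(3)] .
  interpret A: multiplicity_free_system scale d A E \<theta>
    by unfold_locales (use dim CH' \<theta> in auto)
  interpret As: multiplicity_free_system scale d As Es \<theta>s
    by unfold_locales (use dim CH' \<theta>s in auto)

  have x_nonzero: "x i \<noteq> 0" if "i \<le> d" for i
  proof
    assume "x i = 0"
    then have Es_u: "Es i u = 0" by (simp add: x_def)
    obtain z where z: "u = E 0 z" using u(1) by blast
    \<comment> \<open>Here \<open>As\<close> plays the role of \<open>C\<close> relative to the
      idempotents of \<open>A\<close>, with cyclic vector \<open>u = E 0 z\<close>. The conclusion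
      \<open>Es i = 0\<close> contradicts \<open>As.E_nonzero\<close>.\<close>
    have "{v. Es i v = 0} = UNIV"
    proof (rule A.hessenberg_cyclic[of _ As])
      show "subspace {v. Es i v = 0}"
        by (rule subspaceI) (auto simp: As.E_zero As.E_add As.E_scale that)
      show "As v \<in> {v. Es i v = 0}" if "v \<in> {v. Es i v = 0}" for v
        using that \<open>i \<le> d\<close> by (simp add: As.B_E)
      show "E 0 z \<in> {v. Es i v = 0}" "E 0 z \<noteq> 0" using Es_u u(2) z by auto
      show "E k (As (E j v)) = 0" if "k \<le> d" "j + 1 < k" for k j v
      proof -
        have "E k \<circ> As \<circ> E j = (\<lambda>_. 0)"
          using CH'(5) that by (simp add: circular_hessenberg_def)
        then show ?thesis by (simp add: fun_eq_iff)
      qed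
      show "\<exists>v. E (Suc j) (As (E j v)) \<noteq> 0" if "j < d" for j
      proof -
        have "Suc j \<le> d" "j \<le> d" "Suc j = j + 1" using that by auto
        then have "E (Suc j) \<circ> As \<circ> E j \<noteq> (\<lambda>_. 0)"
          using CH'(5) unfolding circular_hessenberg_def by blast
        then show ?thesis by (simp add: fun_eq_iff)
      qed
    qed
    then show False using As.E_nonzero[OF that] by blast
  qed
  have x_basis: "is_basis scale d x"
    using As.eigenvectors_basis[of x] x_nonzero As.B_E by (simp add: x_def)

  \<comment> \<open>Below the diagonal the product in \<open>?T\<close> vanishes by itself, through
    the factor \<open>k = i\<close>. The product in \<open>?S\<close> has no zero factor there, so
    its zeros are put in by hand.\<close>
  let ?T = "mat (d + 1) (d + 1) (\<lambda>(i, j). \<Prod>k=j+1..d. \<theta>s i - \<theta>s k)"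
  let ?S = "mat (d + 1) (d + 1)
    (\<lambda>(i, j). if i \<le> j then 1 / (\<Prod>k\<in>{i..d} - {j}. \<theta>s j - \<theta>s k) else 0)"
  have T: "T = ?T"
    unfolding T_def
    by (rule transition_matrix_eqI[OF x_basis])
      (auto simp: y_def x_def As.v_star_eq intro!: sum.cong)
  have x_eq: "x j = (\<Sum>i=0..d. scale (?S $$ (i, j)) (y i))" if "j \<le> d" for j
  proof -
    have "x j = (\<Sum>i=0..j. scale (?S $$ (i, j)) (y i))"
      unfolding x_def y_def As.E_eq_sum_v_star[OF that]
      using that by (intro sum.cong) auto
    also have "\<dots> = (\<Sum>i=0..d. scale (?S $$ (i, j)) (y i))"
      using that by (intro sum.mono_neutral_left) auto
    finally show ?thesis .
  qed
  \<comment> \<open>The expansion \<open>x_eq\<close> has a second use: the span of \<open>y\<close>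
    contains the basis \<open>x\<close>, so \<open>y\<close> is a basis by counting.\<close>
  have "x j \<in> span (y ` {0..d})" if "j \<le> d" for j
    unfolding x_eq[OF that] by (intro span_sum span_scale span_base) auto
  then have "span (x ` {0..d}) \<subseteq> span (y ` {0..d})"
    by (intro span_minimal) auto
  then have "span (y ` {0..d}) = UNIV"
    using x_basis by (auto simp: is_basis_def)
  then have y_basis: "is_basis scale d y" by (rule is_basisI_span[OF dim])
  have S: "S = ?S"
    unfolding S_def by (rule transition_matrix_eqI[OF y_basis _ x_eq]) auto
  have "upper_triangular T"
    unfolding T by (rule upper_triangularI) (auto intro!: prod_zero)
  moreover have "upper_triangular S"
    unfolding S by (rule upper_triangularI) auto
  ultimately show ?thesis
    using x_basis y_basis by (auto simp: T S)
qed

end
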